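(* Let $St_n$ be the star graph on $n$ vertices. Then the graphical Stirling number of its Mycielskian $M(St_n)$ for exactly $3$ parts is \[ B(M(St_n); 3) = 2^n + 1 . \]
   Context: For a graph $G=(V,E)$, a proper partition of $G$ is a partition of $V$ into non-empty, pairwise disjoint subsets (parts), each of which is an independent set of $G$ (no two vertices in the same part are adjacent). The graphical Stirling number $B(G;k)$ is the number of proper partitions of $G$ into exactly $k$ parts. The star $St_n$ on $n$ vertices has a center $c$ adjacent to $n-1$ leaves $v_1,\dots,v_{n-1}$, and no other edges. Its Mycielskian $M(St_n)$ is the graph on the $2n+1$ vertices $c, v_1,\dots,v_{n-1}, c', v_1',\dots,v_{n-1}', u$ whose edges are exactly: $c v_i$, $c v_i'$, $c' v_i$, and $u v_i'$ for $1\le i\le n-1$, together with $u c'$.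
   Formalization: The formula is stated for stars on n ≥ 2 vertices (at least one leaf); for n = 1 the Mycielskian has vertices c, c', u and only the edge uc', so B = 1 while 2^1 + 1 = 3 and the claim fails. *)

theory Defs
  imports Main "HOL-Library.Disjoint_Sets"
begin

datatype 'a graph = Graph (verts: "'a set") (edges: "'a set set")

definition simple_graph :: "'a graph \<Rightarrow> bool" where
  "simple_graph G \<longleftrightarrow>
     finite (verts G) \<and> (\<forall>e\<in>edges G. e \<subseteq> verts G \<and> card e = 2)"

definition adjacent :: "'a graph \<Rightarrow> 'a \<Rightarrow> 'a \<Rightarrow> bool" where
  "adjacent G x y \<longleftrightarrow> {x, y} \<in> edges G"

definition independent_set :: "'a graph \<Rightarrow> 'a set \<Rightarrow> bool" where
  "independent_set G S \<longleftrightarrow> S \<subseteq> verts G \<and> (\<forall>x\<in>S. \<forall>y\<in>S. \<not> adjacent G x y)"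

definition proper_partition :: "'a graph \<Rightarrow> 'a set set \<Rightarrow> bool" where
  "proper_partition G P \<longleftrightarrow> partition_on (verts G) P \<and> (\<forall>S\<in>P. independent_set G S)"

definition graphical_stirling :: "'a graph \<Rightarrow> nat \<Rightarrow> nat" where
  "graphical_stirling G k = card {P. proper_partition G P \<and> card P = k}"

(* The center is 0 and the leaves are 1, ..., n - 1; meaningful for n >= 1. *)
definition star_graph :: "nat \<Rightarrow> nat graph" where
  "star_graph n = Graph {..<n} {{0, i} | i. 1 \<le> i \<and> i < n}"

datatype 'a myc_vertex = Orig 'a | Copy 'a | Apex

(* The middle family is over ordered pairs (x, y), so each edge {x, y} of G
   contributes both {x, y'} and {y, x'}. *)
definition mycielskian :: "'a graph \<Rightarrow> 'a myc_vertex graph" where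
  "mycielskian G = Graph
     (Orig ` verts G \<union> Copy ` verts G \<union> {Apex})
     ({{Orig x, Orig y} | x y. adjacent G x y} \<union>
      {{Orig x, Copy y} | x y. adjacent G x y} \<union>
      {{Apex, Copy x} | x. x \<in> verts G})"

lemma simple_graph_star_graph: "simple_graph (star_graph n)"
  by (auto simp: simple_graph_def star_graph_def card_insert_if)

lemma simple_graph_mycielskian:
  assumes "simple_graph G"
  shows "simple_graph (mycielskian G)"
proof -
  have "x \<in> verts G \<and> y \<in> verts G \<and> x \<noteq> y" if "adjacent G x y" for x y
    using assms that unfolding simple_graph_def adjacent_def by fastforce
  then show ?thesis
    using assms by (auto simp: simple_graph_def mycielskian_def card_insert_if)
qed

lemma finite_proper_partitions:
  assumes "simple_graph G"
  shows "finite {P. proper_partition G P \<and> card P = k}"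
proof (rule finite_subset)
  show "{P. proper_partition G P \<and> card P = k} \<subseteq> Pow (Pow (verts G))"
    by (auto simp: proper_partition_def partition_on_def)
qed (use assms in \<open>simp add: simple_graph_def\<close>)

lemma card_verts_mycielskian_star_graph:
  "card (verts (mycielskian (star_graph n))) = 2 * n + 1"
proof -
  have "card (Orig ` {..<n} \<union> Copy ` {..<n}) = n + n"
    by (subst card_Un_disjoint) (auto simp: card_image inj_on_def)
  moreover have "Apex \<notin> Orig ` {..<n} \<union> Copy ` {..<n}" by auto
  ultimately show ?thesis
    by (simp add: mycielskian_def star_graph_def)
qed

lemma edges_mycielskian_star_graph:
  assumes "n \<ge> 1"
  shows "edges (mycielskian (star_graph n)) =
    (\<Union>i\<in>{1..<n}. {{Orig 0, Orig i}, {Orig 0, Copy i}, {Copy 0, Orig i}, {Apex, Copy i}})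
      \<union> {{Apex, Copy 0}}" (is "?L = ?R")
proof -
  have adj: "adjacent (star_graph n) x y \<longleftrightarrow>
      (x = 0 \<and> 1 \<le> y \<and> y < n) \<or> (y = 0 \<and> 1 \<le> x \<and> x < n)" for x y
    by (auto simp: adjacent_def star_graph_def doubleton_eq_iff)
  have v: "x \<in> verts (star_graph n) \<longleftrightarrow> x = 0 \<or> (1 \<le> x \<and> x < n)" for x
    using assms by (auto simp: star_graph_def)
  have "?L \<subseteq> ?R"
  proof
    fix e assume "e \<in> ?L"
    then consider
        x y where "e = {Orig x, Orig y}" "adjacent (star_graph n) x y"
      | x y where "e = {Orig x, Copy y}" "adjacent (star_graph n) x y"
      | x where "e = {Apex, Copy x}" "x \<in> verts (star_graph n)"
      unfolding mycielskian_def graph.sel by blast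
    then show "e \<in> ?R"
      by cases (auto simp: adj v doubleton_eq_iff)
  qed
  moreover have "?R \<subseteq> ?L"
  proof -
    have orig: "{Orig 0, Orig i} \<in> ?L" and copy: "{Orig 0, Copy i} \<in> ?L"
      and copy0: "{Orig i, Copy 0} \<in> ?L" and apex: "{Apex, Copy i} \<in> ?L"
      if "i \<in> {1..<n}" for i
      using that unfolding mycielskian_def graph.sel adj v atLeastLessThan_iff by blast+
    have "{Apex, Copy 0} \<in> ?L"
      unfolding mycielskian_def graph.sel v by blast
    with orig copy copy0 apex show ?thesis
      by (auto simp: insert_commute[of "Copy 0"])
  qed
  ultimately show ?thesis by (rule subset_antisym)
qed

end

theory Submission imports Defs begin

text \<open>
  Write \<open>c\<close>, \<open>v\<^sub>i\<close> for the centre and the leaves of the star, \<open>c'\<close>, \<open>v\<^sub>i'\<close> for their copies and \<open>u\<close> for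
  the apex. A proper partition into three parts is determined by where \<open>c\<close>, \<open>u\<close> and \<open>c'\<close> lie,
  together with at most one free binary choice per leaf.

  If \<open>c\<close> and \<open>u\<close> share a part, that part is \<open>{c, u}\<close>, because every other vertex is adjacent to \<open>c\<close>
  or to \<open>u\<close>. The part of \<open>c'\<close> contains no leaf, so all leaves lie in the third part, while each copy
  \<open>v\<^sub>i'\<close> may join either of these two parts: \<open>2 ^ (n - 1)\<close> partitions. If \<open>c\<close> and \<open>u\<close> lie in different
  parts, every \<open>v\<^sub>i'\<close> is forced into the third part. Now \<open>c'\<close> lies either with \<open>c\<close>, and then each \<open>v\<^sub>i\<close>
  freely joins \<open>u\<close> or the third part, which gives \<open>2 ^ (n - 1)\<close> partitions; or it lies in the
  third part, and then each \<open>v\<^sub>i\<close> must join \<open>u\<close>, which gives one partition. The total is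
  \<open>2 * 2 ^ (n - 1) + 1\<close>.

  The three families are given explicitly, two of them indexed by a set \<open>A\<close> of leaves; the set
  of partitions is their disjoint union (\<open>proper_partitions_3_eq\<close>), and \<open>A\<close> can be read off
  from the partition.
\<close>

section \<open>Proper partitions into three parts\<close>

lemma proper_partition_3_iff:
  "proper_partition G {X, Y, Z} \<and> card {X, Y, Z} = 3 \<longleftrightarrow>
     X \<noteq> {} \<and> Y \<noteq> {} \<and> Z \<noteq> {} \<and> X \<inter> Y = {} \<and> X \<inter> Z = {} \<and> Y \<inter> Z = {} \<and>
     X \<union> Y \<union> Z = verts G \<and>
     independent_set G X \<and> independent_set G Y \<and> independent_set G Z"
proof -
  have card: "card {X, Y, Z} = 3 \<longleftrightarrow> X \<noteq> Y \<and> X \<noteq> Z \<and> Y \<noteq> Z"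
    by (auto simp: card_insert_if)
  show ?thesis
  proof (cases "X \<noteq> Y \<and> X \<noteq> Z \<and> Y \<noteq> Z")
    case True
    then have "disjoint {X, Y, Z} \<longleftrightarrow> X \<inter> Y = {} \<and> X \<inter> Z = {} \<and> Y \<inter> Z = {}"
      by (simp add: disjoint_def Int_commute) metis
    then show ?thesis
      using True unfolding card proper_partition_def partition_on_def
      by (simp add: Un_assoc) metis
  next
    case False
    then show ?thesis
      unfolding card by auto
  qed
qed

lemma card_3_obtain_third:
  assumes "card P = 3" "X \<in> P" "Y \<in> P" "X \<noteq> Y"
  obtains Z where "P = {X, Y, Z}"
proof -
  have "finite P"
    using assms(1) by (simp add: card_ge_0_finite)
  then have "card (P - {X, Y}) = 1"
    using assms by (subst card_Diff_subset) auto
  then obtain Z where "P - {X, Y} = {Z}"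
    by (auto simp: card_1_singleton_iff)
  then have "P = {X, Y, Z}"
    using assms by blast
  then show thesis ..
qed

section \<open>Independent sets in the Mycielskian of a star\<close>

lemma verts_mycielskian_star_graph:
  assumes "n \<ge> 1"
  shows "verts (mycielskian (star_graph n)) =
    {Orig 0, Copy 0, Apex} \<union> Orig ` {1..<n} \<union> Copy ` {1..<n}"
proof -
  have "{..<n} = insert 0 {1..<n}"
    using assms by auto
  then show ?thesis
    by (auto simp: mycielskian_def star_graph_def)
qed

text \<open>
  Quantifying over edges instead of pairs of vertices turns an explicit list of edges directly
  into a list of conditions on the set, without comparing unordered pairs.
\<close>

lemma independent_set_iff_no_edge:
  assumes "simple_graph G"
  shows "independent_set G S \<longleftrightarrow> S \<subseteq> verts G \<and> (\<forall>e\<in>edges G. \<not> e \<subseteq> S)"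
proof -
  have "\<exists>x y. e = {x, y}" if "e \<in> edges G" for e
    using assms that unfolding simple_graph_def card_2_iff by metis
  then have "(\<forall>x\<in>S. \<forall>y\<in>S. {x, y} \<notin> edges G) \<longleftrightarrow> (\<forall>e\<in>edges G. \<not> e \<subseteq> S)"
    by (metis empty_subsetI insert_subset)
  then show ?thesis
    unfolding independent_set_def adjacent_def by blast
qed

lemma independent_set_mycielskian_star_graph:
  assumes "n \<ge> 1"
  shows "independent_set (mycielskian (star_graph n)) S \<longleftrightarrow>
    S \<subseteq> {Orig 0, Copy 0, Apex} \<union> Orig ` {1..<n} \<union> Copy ` {1..<n} \<and>
    (\<forall>i\<in>{1..<n}. (Orig 0 \<in> S \<longrightarrow> Orig i \<notin> S \<and> Copy i \<notin> S) \<and>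
      (Copy 0 \<in> S \<longrightarrow> Orig i \<notin> S) \<and> (Apex \<in> S \<longrightarrow> Copy i \<notin> S)) \<and>
    (Apex \<in> S \<longrightarrow> Copy 0 \<notin> S)"
proof -
  note iff = independent_set_iff_no_edge[OF simple_graph_mycielskian[OF simple_graph_star_graph]]
  show ?thesis
    unfolding iff verts_mycielskian_star_graph[OF assms]
      edges_mycielskian_star_graph[OF assms] ball_Un ball_UN ball_simps insert_subset
    by (intro conj_cong refl) auto
qed

section \<open>Three families of partitions\<close>

text \<open>
  The three families, distinguished by which two of the vertices \<open>Orig 0\<close>, \<open>Copy 0\<close>, \<open>Apex\<close> share a
  part, if any. The set \<open>A\<close> holds the indices whose free vertex is put with \<open>Copy 0\<close>,
  respectively with \<open>Apex\<close>.
\<close>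

definition centre_with_apex :: "nat \<Rightarrow> nat set \<Rightarrow> nat myc_vertex set set" where
  "centre_with_apex n A =
     {{Orig 0, Apex}, insert (Copy 0) (Copy ` A), Orig ` {1..<n} \<union> Copy ` ({1..<n} - A)}"

definition centre_with_copy :: "nat \<Rightarrow> nat set \<Rightarrow> nat myc_vertex set set" where
  "centre_with_copy n A =
     {{Orig 0, Copy 0}, insert Apex (Orig ` A), Copy ` {1..<n} \<union> Orig ` ({1..<n} - A)}"

definition centre_alone :: "nat \<Rightarrow> nat myc_vertex set set" where
  "centre_alone n =
     {{Orig 0}, insert Apex (Orig ` {1..<n}), insert (Copy 0) (Copy ` {1..<n})}"

text \<open>
  At least one leaf is needed: without it the third part of the first two families would be empty.
\<close>

lemma centre_with_apex_proper:
  assumes "n \<ge> 2" "A \<subseteq> {1..<n}"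
  shows "proper_partition (mycielskian (star_graph n)) (centre_with_apex n A) \<and>
    card (centre_with_apex n A) = 3"
proof -
  have n: "n \<ge> 1" "{1..<n} \<noteq> {}"
    using assms(1) by auto
  show ?thesis
    unfolding centre_with_apex_def proper_partition_3_iff
      independent_set_mycielskian_star_graph[OF n(1)] verts_mycielskian_star_graph[OF n(1)]
    using n(2) assms(2) by auto
qed

lemma centre_with_copy_proper:
  assumes "n \<ge> 2" "A \<subseteq> {1..<n}"
  shows "proper_partition (mycielskian (star_graph n)) (centre_with_copy n A) \<and>
    card (centre_with_copy n A) = 3"
proof -
  have n: "n \<ge> 1" "{1..<n} \<noteq> {}"
    using assms(1) by auto
  show ?thesis
    unfolding centre_with_copy_def proper_partition_3_iff
      independent_set_mycielskian_star_graph[OF n(1)] verts_mycielskian_star_graph[OF n(1)]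
    using n(2) assms(2) by auto
qed

lemma centre_alone_proper:
  assumes "n \<ge> 1"
  shows "proper_partition (mycielskian (star_graph n)) (centre_alone n) \<and>
    card (centre_alone n) = 3"
  unfolding centre_alone_def proper_partition_3_iff
    independent_set_mycielskian_star_graph[OF assms] verts_mycielskian_star_graph[OF assms]
  by auto

section \<open>Every partition belongs to one of the families\<close>

text \<open>
  Two parts determine the third as their complement. These two are the part of \<open>Orig 0\<close> together with
  the part of \<open>Apex\<close>, or with that of \<open>Copy 0\<close> when \<open>Orig 0\<close> and \<open>Apex\<close> share a part. Independence then
  leaves a choice for at most one vertex per leaf, and \<open>A\<close> records it.
\<close>

lemma proper_partition_3_cases:
  assumes "n \<ge> 1"
    and proper: "proper_partition (mycielskian (star_graph n)) P" and card: "card P = 3"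
  shows "P \<in> centre_with_apex n ` Pow {1..<n} \<union> centre_with_copy n ` Pow {1..<n} \<union>
    {centre_alone n}"
proof -
  let ?L = "{1..<n}"
  have union: "\<Union>P = {Orig 0, Copy 0, Apex} \<union> Orig ` ?L \<union> Copy ` ?L"
    using proper verts_mycielskian_star_graph[OF \<open>n \<ge> 1\<close>]
    by (simp add: proper_partition_def partition_on_def)
  then obtain X Y where X: "X \<in> P" "Orig 0 \<in> X" and Y: "Y \<in> P" "Apex \<in> Y"
    by (metis UnCI UnionE insertCI)
  have indep: "independent_set (mycielskian (star_graph n)) S" if "S \<in> P" for S
    using proper that by (simp add: proper_partition_def)
  note indep_iff = independent_set_mycielskian_star_graph[OF \<open>n \<ge> 1\<close>]
  note parts_iff = proper_partition_3_iff verts_mycielskian_star_graph[OF \<open>n \<ge> 1\<close>]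
  show ?thesis
  proof (cases "X = Y")
    case True
    from union obtain W where W: "W \<in> P" "Copy 0 \<in> W"
      by (metis UnCI UnionE insertCI)
    have "Copy 0 \<notin> X" and X_eq: "X = {Orig 0, Apex}"
      using indep[OF X(1)] X Y True unfolding indep_iff by auto
    from \<open>Copy 0 \<notin> X\<close> W(2) have "X \<noteq> W"
      by metis
    obtain Z where P: "P = {X, W, Z}"
      by (rule card_3_obtain_third[OF card X(1) W(1) \<open>X \<noteq> W\<close>])
    have facts: "X \<inter> W = {}" "X \<inter> Z = {}" "W \<inter> Z = {}"
        "X \<union> W \<union> Z = {Orig 0, Copy 0, Apex} \<union> Orig ` ?L \<union> Copy ` ?L"
      by (insert conjI[OF proper card, unfolded P parts_iff], (elim conjE, assumption)+)
    have no_leaf: "\<forall>i\<in>?L. Orig i \<notin> W"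
      using indep[OF W(1)] W(2) unfolding indep_iff by simp
    let ?A = "{i \<in> ?L. Copy i \<in> W}"
    have "W = insert (Copy 0) (Copy ` ?A)"
    proof -
      have "W \<subseteq> {Orig 0, Copy 0, Apex} \<union> Orig ` ?L \<union> Copy ` ?L"
        unfolding facts(4)[symmetric] by blast
      moreover have "Orig 0 \<notin> W" "Apex \<notin> W"
        using facts(1) X_eq by simp_all
      ultimately have "W \<subseteq> insert (Copy 0) (Copy ` ?L)"
        using no_leaf by blast
      then show ?thesis
        using W(2) by blast
    qed
    moreover have "Z = Orig ` ?L \<union> Copy ` (?L - ?A)"
    proof -
      have "Z = ({Orig 0, Copy 0, Apex} \<union> Orig ` ?L \<union> Copy ` ?L) - X - W"
        using facts by blast
      also have "\<dots> = Orig ` ?L \<union> Copy ` (?L - ?A)"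
        using no_leaf W(2) X_eq by auto
      finally show ?thesis .
    qed
    ultimately have "P = centre_with_apex n ?A"
      unfolding P centre_with_apex_def using X_eq by metis
    then show ?thesis
      by blast
  next
    case False
    obtain Z where P: "P = {X, Y, Z}"
      by (rule card_3_obtain_third[OF card X(1) Y(1) False])
    have facts: "X \<inter> Y = {}" "X \<inter> Z = {}" "Y \<inter> Z = {}"
        "X \<union> Y \<union> Z = {Orig 0, Copy 0, Apex} \<union> Orig ` ?L \<union> Copy ` ?L"
      by (insert conjI[OF proper card, unfolded P parts_iff], (elim conjE, assumption)+)
    have forced: "\<forall>i\<in>?L. Orig i \<notin> X \<and> Copy i \<notin> X" "\<forall>i\<in>?L. Copy i \<notin> Y" "Copy 0 \<notin> Y"
      using indep[OF X(1)] indep[OF Y(1)] X(2) Y(2) unfolding indep_iff by simp_all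
    have X_sub: "X \<subseteq> {Orig 0, Copy 0, Apex} \<union> Orig ` ?L \<union> Copy ` ?L"
      and Y_sub: "Y \<subseteq> {Orig 0, Copy 0, Apex} \<union> Orig ` ?L \<union> Copy ` ?L"
      unfolding facts(4)[symmetric] by blast+
    have not_in: "Apex \<notin> X" "Orig 0 \<notin> Y"
      using facts(1) X(2) Y(2) by blast+
    have Z: "Z = ({Orig 0, Copy 0, Apex} \<union> Orig ` ?L \<union> Copy ` ?L) - X - Y"
      using facts by blast
    show ?thesis
    proof (cases "Copy 0 \<in> X")
      case True
      let ?A = "{i \<in> ?L. Orig i \<in> Y}"
      have X_eq: "X = {Orig 0, Copy 0}"
        using X_sub forced(1) not_in(1) X(2) True by blast
      have "Y \<subseteq> insert Apex (Orig ` ?L)"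
        using Y_sub forced(2,3) not_in(2) by blast
      then have "Y = insert Apex (Orig ` ?A)"
        using Y(2) by blast
      moreover have "Z = Copy ` ?L \<union> Orig ` (?L - ?A)"
        unfolding Z using forced(2) X_eq Y(2) by auto
      ultimately have "P = centre_with_copy n ?A"
        unfolding P centre_with_copy_def using X_eq by metis
      then show ?thesis
        by blast
    next
      case False
      then have "Copy 0 \<in> Z"
        unfolding Z using forced(3) by simp
      have "Z \<in> P"
        unfolding P by simp
      then have "\<forall>i\<in>?L. Orig i \<notin> Z"
        using indep[of Z] \<open>Copy 0 \<in> Z\<close> unfolding indep_iff by simp
      then have leaves: "Orig ` ?L \<subseteq> Y"
        unfolding Z using forced(1) by blast
      have X_eq: "X = {Orig 0}"
        using X_sub forced(1) not_in(1) X(2) False by blast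
      moreover have Y_eq: "Y = insert Apex (Orig ` ?L)"
      proof
        show "Y \<subseteq> insert Apex (Orig ` ?L)"
          using Y_sub forced(2,3) not_in(2) by blast
        show "insert Apex (Orig ` ?L) \<subseteq> Y"
          using leaves Y(2) by simp
      qed
      moreover have "Z = insert (Copy 0) (Copy ` ?L)"
        unfolding Z X_eq Y_eq by auto
      ultimately have "P = centre_alone n"
        unfolding P centre_alone_def by metis
      then show ?thesis
        by blast
    qed
  qed
qed

lemma proper_partitions_3_eq:
  assumes "n \<ge> 2"
  shows "{P. proper_partition (mycielskian (star_graph n)) P \<and> card P = 3} =
    centre_with_apex n ` Pow {1..<n} \<union> centre_with_copy n ` Pow {1..<n} \<union> {centre_alone n}"
proof (intro subset_antisym subsetI)
  show "P \<in> centre_with_apex n ` Pow {1..<n} \<union> centre_with_copy n ` Pow {1..<n} \<union>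
      {centre_alone n}"
    if "P \<in> {P. proper_partition (mycielskian (star_graph n)) P \<and> card P = 3}" for P
    using that assms proper_partition_3_cases[of n P] by simp
next
  show "P \<in> {P. proper_partition (mycielskian (star_graph n)) P \<and> card P = 3}"
    if "P \<in> centre_with_apex n ` Pow {1..<n} \<union> centre_with_copy n ` Pow {1..<n} \<union>
      {centre_alone n}" for P
    using that assms centre_with_apex_proper centre_with_copy_proper centre_alone_proper[of n]
    by auto
qed

section \<open>Counting\<close>

text \<open>
  The set \<open>A\<close> is recovered as the nonzero indices whose free vertex shares a part with \<open>Copy 0\<close>.
  Index \<open>0\<close> carries no information, as \<open>Copy 0\<close> always shares a part with itself.
\<close>

lemma inj_on_centre_with_apex: "inj_on (centre_with_apex n) (Pow {1..<n})"
proof (rule inj_on_inverseI)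
  show "{i. i \<noteq> 0 \<and> (\<exists>S\<in>centre_with_apex n A. Copy 0 \<in> S \<and> Copy i \<in> S)} = A"
    if "A \<in> Pow {1..<n}" for A
    unfolding centre_with_apex_def using that by auto
qed

text \<open>The set \<open>A\<close> is recovered as the indices whose free vertex shares a part with \<open>Apex\<close>.\<close>

lemma inj_centre_with_copy: "inj (centre_with_copy n)"
proof (rule inj_on_inverseI)
  show "{i. \<exists>S\<in>centre_with_copy n A. Apex \<in> S \<and> Orig i \<in> S} = A" for A
    unfolding centre_with_copy_def by auto
qed

theorem corollary5:
  fixes n :: nat
  assumes "n \<ge> 2"
  shows "graphical_stirling (mycielskian (star_graph n)) 3 = 2 ^ n + 1"
proof -
  let ?F = "centre_with_apex n ` Pow {1..<n}" and ?G = "centre_with_copy n ` Pow {1..<n}"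
  have card_F: "card ?F = 2 ^ (n - 1)"
    by (subst card_image) (simp_all add: inj_on_centre_with_apex[simplified] card_Pow)
  have card_G: "card ?G = 2 ^ (n - 1)"
    by (subst card_image) (auto intro: inj_on_subset[OF inj_centre_with_copy] simp: card_Pow)
  \<comment> \<open>Whether the centre shares a part with the apex, or with its copy, separates the families.\<close>
  let ?apex = "\<lambda>P. \<exists>S\<in>P. Orig 0 \<in> S \<and> Apex \<in> S"
  let ?copy = "\<lambda>P. \<exists>S\<in>P. Orig 0 \<in> S \<and> Copy 0 \<in> S"
  have F: "?apex P" if "P \<in> ?F" for P
    using that by (auto simp: centre_with_apex_def)
  have G: "\<not> ?apex P" "?copy P" if "P \<in> ?G" for P
    using that unfolding centre_with_copy_def by auto
  have alone: "\<not> ?apex (centre_alone n)" "\<not> ?copy (centre_alone n)"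
    by (auto simp: centre_alone_def)
  have "?F \<inter> ?G = {}"
    by (rule equals0I) (metis F G(1) IntE)
  moreover have "centre_alone n \<notin> ?F" "centre_alone n \<notin> ?G"
    using F alone(1) G(2) alone(2) by metis+
  ultimately have "card (?F \<union> ?G \<union> {centre_alone n}) = 2 ^ (n - 1) + 2 ^ (n - 1) + 1"
    by (simp add: card_Un_disjoint card_F[simplified] card_G[simplified])
  also have "\<dots> = 2 ^ n + 1"
    using assms by (cases n) auto
  finally show ?thesis
    unfolding graphical_stirling_def proper_partitions_3_eq[OF assms] .
qed

end
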